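(* Let $\mathbf F_q$ be the finite field with $q$ elements and $m$ a positive integer. For $n\ge0$ let $T^{q,m}_n$ be the set of orbits of $GL_m(\mathbf F_q)$ acting on $(\mathbf F_q^m)^n$ by $g\cdot(x_1,\dots,x_n)=(g(x_1),\dots,g(x_n))$. Then $$\sum_{n=0}^\infty |T^{q,m}_n|\,t^n=\sum_{i=0}^m t^i\prod_{r=0}^i\frac1{1-q^rt}.$$ *)

theory Defs
  imports
    "HOL-Analysis.Cartesian_Space"
    "HOL-Computational_Algebra.Formal_Power_Series"
    "HOL-Algebra.Group_Action"
begin

definition GL :: "('a::field ^ 'm::finite ^ 'm) monoid" where
  "GL = \<lparr>carrier = {A. invertible A}, mult = (\<lambda>A B. A ** B), one = mat 1\<rparr>"

definition tuples :: "nat \<Rightarrow> 'b list set" where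
  "tuples n = {xs. length xs = n}"

text \<open>The action is restricted to \<open>tuples n\<close> because \<^const>\<open>BijGroup\<close>, and hence
  \<^locale>\<open>group_action\<close>, requires extensional functions.\<close>

definition GL_action :: "nat \<Rightarrow> 'a::field ^ 'm::finite ^ 'm \<Rightarrow> ('a ^ 'm) list \<Rightarrow> ('a ^ 'm) list" where
  "GL_action n g = (\<lambda>xs \<in> tuples n. map (\<lambda>x. g *v x) xs)"

definition GL_orbits :: "nat \<Rightarrow> ('a::field ^ 'm::finite) list set set" where
  "GL_orbits n = orbits GL (tuples n) (GL_action n)"

lemma group_GL: "group (GL :: ('a::field ^ 'm::finite ^ 'm) monoid)"
proof (rule groupI)
  fix A B :: "'a ^ 'm ^ 'm"
  assume "A \<in> carrier GL" "B \<in> carrier GL"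
  then obtain A' B' where A': "A ** A' = mat 1" "A' ** A = mat 1"
    and B': "B ** B' = mat 1" "B' ** B = mat 1"
    by (auto simp: GL_def invertible_def)
  have "(A ** B) ** (B' ** A') = A ** (B ** B') ** A'"
    by (simp only: matrix_mul_assoc)
  moreover have "(B' ** A') ** (A ** B) = B' ** (A' ** A) ** B"
    by (simp only: matrix_mul_assoc)
  ultimately have "invertible (A ** B)"
    unfolding invertible_def using A' B' by (intro exI[of _ "B' ** A'"]) simp
  then show "A \<otimes>\<^bsub>GL\<^esub> B \<in> carrier GL"
    by (simp add: GL_def)
next
  show "\<one>\<^bsub>GL\<^esub> \<in> carrier (GL :: ('a ^ 'm ^ 'm) monoid)"
    by (auto simp: GL_def invertible_def intro!: exI[of _ "mat 1"])
next
  fix A :: "'a ^ 'm ^ 'm"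
  assume "A \<in> carrier GL"
  then show "\<exists>B\<in>carrier GL. B \<otimes>\<^bsub>GL\<^esub> A = \<one>\<^bsub>GL\<^esub>"
    by (auto simp: GL_def invertible_def)
qed (auto simp: GL_def matrix_mul_assoc)

lemma group_action_GL:
  "group_action (GL :: ('a::field ^ 'm::finite ^ 'm) monoid) (tuples n) (GL_action n)"
proof -
  have mult: "compose (tuples n) (GL_action n A) (GL_action n B) = GL_action n (A ** B)"
    for A B :: "'a ^ 'm ^ 'm"
    by (rule ext) (simp add: GL_action_def tuples_def compose_def restrict_def
        matrix_vector_mul_assoc comp_def)
  have Bij: "GL_action n A \<in> Bij (tuples n)" if A: "invertible A" for A :: "'a ^ 'm ^ 'm"
  proof -
    obtain A' where A': "A ** A' = mat 1" "A' ** A = mat 1"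
      using A by (auto simp: invertible_def)
    have "bij_betw (GL_action n A) (tuples n) (tuples n)"
      by (rule bij_betw_byWitness[where f' = "GL_action n A'"])
        (auto simp: GL_action_def tuples_def comp_def matrix_vector_mul_assoc A')
    then show ?thesis
      by (simp add: Bij_def GL_action_def)
  qed
  have "GL_action n \<in> hom (GL :: ('a ^ 'm ^ 'm) monoid) (BijGroup (tuples n))"
    by (auto simp: hom_def GL_def BijGroup_def Bij mult)
  then show ?thesis
    by (simp add: group_action_def group_hom_def group_hom_axioms_def group_GL group_BijGroup)
qed

end

theory Submission
  imports Defs
begin

text \<open>
  Fix a basis \<open>e\<^sub>0, \<dots>, e\<^sub>m\<^sub>-\<^sub>1\<close> and let \<open>E\<^sub>i\<close> be the span of the first \<open>i\<close> basis vectors. Reading a tuple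
  from its last entry to its first, every orbit has exactly one representative in which each new
  entry either lies in the span \<open>E\<^sub>i\<close> of the entries read so far or equals \<open>e\<^sub>i\<close>: any vector outside
  \<open>E\<^sub>i\<close> can be moved to \<open>e\<^sub>i\<close> while fixing \<open>E\<^sub>i\<close> pointwise. The number of representatives of length
  \<open>n\<close> and rank \<open>i\<close> therefore satisfies \<open>c(n+1, i) = q\<^sup>i c(n, i) + c(n, i-1)\<close>, so the generating
  functions satisfy \<open>(1 - q\<^sup>i t) F\<^sub>i = t F\<^sub>i\<^sub>-\<^sub>1\<close> with \<open>(1 - t) F\<^sub>0 = 1\<close>.
\<close>

section \<open>Counting orbits by a transversal\<close>

lemma (in group_action) card_orbits_transversal:
  assumes "T \<subseteq> E"
    and ex: "\<And>x. x \<in> E \<Longrightarrow> \<exists>c\<in>T. c \<in> orbit G \<phi> x"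
    and uniq: "\<And>c c'. c \<in> T \<Longrightarrow> c' \<in> T \<Longrightarrow> c' \<in> orbit G \<phi> c \<Longrightarrow> c = c'"
  shows "card (orbits G E \<phi>) = card T"
proof -
  have orbit_subset: "orbit G \<phi> x \<subseteq> E" if "x \<in> E" for x
    using that element_image by (auto simp: orbit_def)
  have orbit_le: "orbit G \<phi> y \<subseteq> orbit G \<phi> x" if "x \<in> E" "y \<in> orbit G \<phi> x" for x y
  proof
    fix z assume "z \<in> orbit G \<phi> y"
    then show "z \<in> orbit G \<phi> x"
      using orbit_trans[of x y z] orbit_subset that by (meson subsetD)
  qed
  have orbit_eq: "orbit G \<phi> x = orbit G \<phi> y" if "x \<in> E" "y \<in> orbit G \<phi> x" for x y
    using orbit_le[of x y] orbit_le[of y x] orbit_sym[of x y] orbit_subset[of x] that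
    by (meson subset_antisym subsetD)
  have "orbits G E \<phi> = orbit G \<phi> ` T"
  proof
    show "orbits G E \<phi> \<subseteq> orbit G \<phi> ` T"
    proof
      fix X assume "X \<in> orbits G E \<phi>"
      then obtain x where x: "x \<in> E" "X = orbit G \<phi> x"
        by (auto simp: orbits_def)
      then obtain c where "c \<in> T" "c \<in> orbit G \<phi> x"
        using ex by auto
      then show "X \<in> orbit G \<phi> ` T"
        using orbit_eq[OF x(1)] x(2) by auto
    qed
    show "orbit G \<phi> ` T \<subseteq> orbits G E \<phi>"
      using \<open>T \<subseteq> E\<close> by (auto simp: orbits_def)
  qed
  \<comment> \<open>Equal orbits put c' in the orbit of c by reflexivity, and two points of T in one
    orbit coincide.\<close>
  moreover have "inj_on (orbit G \<phi>) T"
  proof (rule inj_onI)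
    fix c c' assume c: "c \<in> T" "c' \<in> T" "orbit G \<phi> c = orbit G \<phi> c'"
    then have "c' \<in> orbit G \<phi> c"
      using orbit_refl[of c'] \<open>T \<subseteq> E\<close> by auto
    then show "c = c'"
      using uniq c by simp
  qed
  ultimately show ?thesis
    by (simp add: card_image)
qed

lemma GL_orbit_iff:
  assumes "xs \<in> tuples n"
  shows "ys \<in> orbit GL (GL_action n) xs \<longleftrightarrow> (\<exists>g. invertible g \<and> ys = map ((*v) g) xs)"
  using assms by (auto simp: orbit_def GL_def GL_action_def)

section \<open>Spans, invertible matrices and geometric series\<close>

lemma invertible_mat_1: "invertible (mat 1 :: 'a::semiring_1 ^ 'm::finite ^ 'm)"
  unfolding invertible_def by (intro exI[of _ "mat 1"]) simp

text \<open>Each vector of the larger span is k a + w with w in the span of S. The pair (k, w) is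
  unique: if two pairs with different scalars agreed, dividing by k - l would put a into the span of
  S.\<close>

lemma card_span_insert:
  fixes a :: "'a::{field,finite} ^ 'm::finite"
  assumes "a \<notin> vec.span S"
  shows "card (vec.span (insert a S)) = CARD('a) * card (vec.span S)"
proof -
  let ?f = "\<lambda>(k, w). k *s a + w"
  have "inj_on ?f (UNIV \<times> vec.span S)"
  proof (intro inj_onI, clarsimp)
    fix k w l v
    assume w: "w \<in> vec.span S" and v: "v \<in> vec.span S" and eq: "k *s a + w = l *s a + v"
    have "(k - l) *s a = v - w"
      using eq by (simp add: vec.scale_left_diff_distrib algebra_simps)
    then have "(k - l) *s a \<in> vec.span S"
      using vec.span_diff[OF v w] by simp
    then have "inverse (k - l) *s ((k - l) *s a) \<in> vec.span S"
      by (rule vec.span_scale)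
    then have "k = l"
      using assms by (cases "k = l") (auto simp: vector_smult_assoc)
    with eq show "k = l \<and> w = v"
      by simp
  qed
  moreover have "vec.span (insert a S) = ?f ` (UNIV \<times> vec.span S)"
  proof -
    have "x \<in> ?f ` (UNIV \<times> vec.span S)" if "x - k *s a \<in> vec.span S" for x k
      using that by (intro image_eqI[where x = "(k, x - k *s a)"]) auto
    moreover have "k *s a + w \<in> vec.span (insert a S)" if "w \<in> vec.span S" for k w
      using that by (auto simp: vec.span_breakdown_eq intro!: exI[of _ k])
    ultimately show ?thesis
      by (auto simp: vec.span_breakdown_eq[of _ a S])
  qed
  ultimately show ?thesis
    by (simp add: card_image card_cartesian_product)
qed

text \<open>Sending x to y and fixing B is an injection between independent sets, so it extends to
  an injective linear map, whose matrix is invertible because the dimension is finite. This moves a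
  new entry to a basis vector without disturbing the entries already normalised.\<close>

lemma matrix_fix_map_if_independent:
  fixes x y :: "'a::field ^ 'm::finite"
  assumes B: "vec.independent B" and x: "x \<notin> vec.span B" and y: "y \<notin> vec.span B"
  obtains g where "invertible g" "g *v x = y" "\<And>b. b \<in> vec.span B \<Longrightarrow> g *v b = b"
proof -
  have notin: "x \<notin> B" "y \<notin> B"
    using x y vec.span_base by blast+
  let ?f = "\<lambda>b. if b = x then y else b"
  have img: "?f ` insert x B = insert y B"
    using notin by auto
  have "inj_on ?f (insert x B)"
    using notin by (auto simp: inj_on_def)
  moreover have "vec.independent (insert x B)" "vec.independent (?f ` insert x B)"
    unfolding img by (rule vec.independent_insertI[OF _ B], fact)+
  ultimately obtain h where h: "Vector_Spaces.linear (*s) (*s) h" "inj h" "\<forall>b\<in>insert x B. h b = ?f b"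
    using vec.linear_independent_extend_inj[of "insert x B" ?f] by blast
  have mat: "(*v) (matrix h) = h"
    using matrix_works[OF h(1)] by blast
  show ?thesis
  proof (rule that[of "matrix h"])
    show "invertible (matrix h)"
      using h(2) by (simp add: invertible_left_inverse matrix_left_invertible_injective mat)
    show "matrix h *v x = y"
      using h(3) by (simp add: mat)
    show "matrix h *v b = b" if "b \<in> vec.span B" for b
      by (rule vec.linear_eq_on[OF matrix_vector_mul_linear_gen vec.linear_ident that])
        (use h(3) notin in \<open>auto simp: mat\<close>)
  qed
qed

text \<open>A recurrence whose next term contains c times the current one takes this form. It can be
  solved for F because 1 - c X has constant coefficient 1 and is therefore a unit.\<close>

lemma fps_eq_divide_geometric:
  fixes F G :: "'a::field fps"
  assumes "F = G + fps_const c * F * fps_X"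
  shows "F = G * (1 / (1 - fps_const c * fps_X))"
proof -
  have "F * (1 - fps_const c * fps_X) = G"
    using assms by (simp add: algebra_simps)
  then have "G * inverse (1 - fps_const c * fps_X) =
      F * ((1 - fps_const c * fps_X) * inverse (1 - fps_const c * fps_X))"
    by (simp add: mult.assoc)
  also have "\<dots> = F"
    by (subst inverse_mult_eq_1') simp_all
  finally show ?thesis
    by (simp add: fps_divide_unit)
qed

section \<open>Canonical tuples of given length and rank\<close>

primrec canon :: "(nat \<Rightarrow> 'a::field ^ 'm::finite) \<Rightarrow> nat \<Rightarrow> nat \<Rightarrow> ('a ^ 'm) list set" where
  "canon e 0 i = (if i = 0 then {[]} else {})"
| "canon e (Suc n) i =
    (\<lambda>(x, xs). x # xs) ` (vec.span (e ` {..<i}) \<times> canon e n i) \<union>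
    (case i of 0 \<Rightarrow> {} | Suc j \<Rightarrow> (#) (e j) ` canon e n j)"

lemma canon_subset_tuples: "canon e n i \<subseteq> tuples n"
proof (induction n arbitrary: i)
  case (Suc n)
  have "length xs = n" if "xs \<in> canon e n j" for xs j
    using Suc[of j] that by (auto simp: tuples_def)
  then show ?case
    by (auto simp: tuples_def split: nat.splits)
qed (simp add: tuples_def)

lemma finite_canon: "finite (canon e n i)" for e :: "nat \<Rightarrow> 'a::{field,finite} ^ 'm::finite"
  by (induction n arbitrary: i) (auto split: nat.splits)

text \<open>An entry taken from the span adds nothing, and e j enlarges the span from E_j to
  E_(j+1). Hence a linear map that fixes all entries fixes E_i pointwise, and conversely.\<close>

lemma span_canon: "xs \<in> canon e n i \<Longrightarrow> vec.span (set xs) = vec.span (e ` {..<i})"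
proof (induction n arbitrary: xs i)
  case 0
  then show ?case
    by (simp split: if_splits)
next
  case (Suc n)
  consider x ys where "xs = x # ys" "x \<in> vec.span (e ` {..<i})" "ys \<in> canon e n i"
    | j ys where "xs = e j # ys" "i = Suc j" "ys \<in> canon e n j"
    using Suc.prems by (auto split: nat.splits)
  then show ?case
  proof cases
    case 1
    then show ?thesis
      using Suc.IH[of ys i] by (simp add: vec.span_redundant)
  next
    case 2
    then show ?thesis
      using Suc.IH[of ys j] by (simp add: lessThan_Suc vec.span_insert)
  qed
qed

section \<open>Canonical tuples over a fixed basis: their number, existence and uniqueness in each
  orbit\<close>

context
  fixes e :: "nat \<Rightarrow> 'a::{field,finite} ^ 'm::finite"
  assumes inj_e: "inj_on e {..<CARD('m)}"
    and independent_e: "vec.independent (e ` {..<CARD('m)})"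
begin

lemma independent_initial: "i \<le> CARD('m) \<Longrightarrow> vec.independent (e ` {..<i})"
  by (rule vec.independent_mono[OF independent_e]) auto

lemma notin_span_initial:
  assumes "i < CARD('m)"
  shows "e i \<notin> vec.span (e ` {..<i})"
proof -
  have "e i \<notin> e ` {..<i}"
    using assms inj_onD[OF inj_e] by fastforce
  then show ?thesis
    using independent_initial[of "Suc i"] assms
    by (auto simp: lessThan_Suc vec.independent_insert)
qed

lemma span_initial_UNIV: "vec.span (e ` {..<CARD('m)}) = UNIV"
proof -
  have "card (e ` {..<CARD('m)}) = vec.dim (UNIV :: ('a ^ 'm) set)"
    using inj_e by (simp add: card_image card_cart_basis)
  then show ?thesis
    using vec.card_eq_dim[of "e ` {..<CARD('m)}" UNIV] independent_e by auto
qed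

lemma card_span_initial: "i \<le> CARD('m) \<Longrightarrow> card (vec.span (e ` {..<i})) = CARD('a) ^ i"
proof (induction i)
  case (Suc i)
  then show ?case
    using card_span_insert[OF notin_span_initial[of i]] by (simp add: lessThan_Suc)
qed simp

lemma card_canon_Suc:
  assumes "i \<le> CARD('m)"
  shows "card (canon e (Suc n) i) =
    CARD('a) ^ i * card (canon e n i) + (case i of 0 \<Rightarrow> 0 | Suc j \<Rightarrow> card (canon e n j))"
proof -
  let ?A = "(\<lambda>(x, xs). x # xs) ` (vec.span (e ` {..<i}) \<times> canon e n i)"
  let ?B = "case i of 0 \<Rightarrow> {} | Suc j \<Rightarrow> (#) (e j) ` canon e n j"
  have "card ?A = CARD('a) ^ i * card (canon e n i)"
    using assms by (subst card_image) (auto simp: inj_on_def card_cartesian_product card_span_initial)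
  moreover have "card ?B = (case i of 0 \<Rightarrow> 0 | Suc j \<Rightarrow> card (canon e n j))"
    by (auto simp: card_image split: nat.splits)
  moreover have "?A \<inter> ?B = {}"
  proof (cases i)
    case (Suc j)
    \<comment> \<open>The two kinds of tuples differ already in their tails: a common tail would
      have both E_i and E_j as span, but e j lies only in the former.\<close>
    have "ys \<notin> canon e n i" if "ys \<in> canon e n j" for ys
    proof
      assume "ys \<in> canon e n i"
      then have "vec.span (e ` {..<i}) = vec.span (e ` {..<j})"
        using span_canon that by metis
      moreover have "e j \<in> vec.span (e ` {..<i})"
        using Suc by (auto intro: vec.span_base)
      ultimately show False
        using notin_span_initial[of j] Suc assms by simp
    qed
    then show ?thesis
      using Suc by auto
  qed simp
  ultimately show ?thesis
    unfolding canon.simps by (subst card_Un_disjoint) (auto simp: finite_canon split: nat.splits)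
qed

lemma canon_exists:
  fixes xs :: "('a ^ 'm) list"
  shows "\<exists>g i. invertible g \<and> i \<le> CARD('m) \<and> map ((*v) g) xs \<in> canon e (length xs) i"
proof (induction xs)
  case Nil
  show ?case
    by (auto intro!: exI[of _ "mat 1"] invertible_mat_1)
next
  case (Cons x xs)
  then obtain g i where g: "invertible g" and i: "i \<le> CARD('m)"
    and canon: "map ((*v) g) xs \<in> canon e (length xs) i"
    by blast
  show ?case
  proof (cases "g *v x \<in> vec.span (e ` {..<i})")
    case True
    then show ?thesis
      using g i canon by (intro exI[of _ g] exI[of _ i]) auto
  next
    case False
    \<comment> \<open>E_m is the whole space, so a vector outside E_i leaves a basis vector e i to
      move it to.\<close>
    then have less: "i < CARD('m)"
      using i span_initial_UNIV by (metis UNIV_I le_neq_implies_less)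
    then obtain h where h: "invertible h" "h *v (g *v x) = e i"
      and fix_h: "\<And>b. b \<in> vec.span (e ` {..<i}) \<Longrightarrow> h *v b = b"
      using matrix_fix_map_if_independent[OF independent_initial False notin_span_initial] i by metis
    have "map ((*v) (h ** g)) (x # xs) = e i # map ((*v) g) xs"
    proof -
      \<comment> \<open>The normalised tail lies in E_i, which h fixes pointwise.\<close>
      have "h *v (g *v y) = g *v y" if "y \<in> set xs" for y
        using that fix_h span_canon[OF canon] vec.span_base[of "g *v y" "set (map ((*v) g) xs)"]
        by simp
      then show ?thesis
        using h(2) by (simp flip: matrix_vector_mul_assoc)
    qed
    then show ?thesis
      using less canon invertible_mult[OF h(1) g]
      by (intro exI[of _ "h ** g"] exI[of _ "Suc i"]) (simp del: list.map)
  qed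
qed

text \<open>By induction g fixes the tail, hence its span, pointwise. If the head lies in that span,
  it is fixed as well. Otherwise its image is also outside, and the only head allowed outside is the
  next basis vector, for both tuples.\<close>

lemma canon_unique:
  fixes xs :: "('a ^ 'm) list"
  assumes "xs \<in> canon e n i" "map ((*v) g) xs \<in> canon e n j" "invertible g"
    "i \<le> CARD('m)" "j \<le> CARD('m)"
  shows "map ((*v) g) xs = xs \<and> i = j"
  using assms
proof (induction n arbitrary: xs i j)
  case 0
  then show ?case
    by (simp split: if_splits)
next
  case (Suc n)
  obtain x ys i' where xs: "xs = x # ys" and ys: "ys \<in> canon e n i'"
    and x: "x \<in> vec.span (e ` {..<i'}) \<and> i = i' \<or> x = e i' \<and> i = Suc i'"
    using Suc.prems(1) by (auto split: nat.splits)
  obtain j' where gys: "map ((*v) g) ys \<in> canon e n j'"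
    and gx: "g *v x \<in> vec.span (e ` {..<j'}) \<and> j = j' \<or> g *v x = e j' \<and> j = Suc j'"
    using Suc.prems(2) xs by (auto split: nat.splits)
  have fix_ys: "map ((*v) g) ys = ys" and "i' = j'"
    using Suc.IH[OF ys gys \<open>invertible g\<close>] x gx Suc.prems by auto
  have fix_g: "g *v v = v" if "v \<in> vec.span (e ` {..<i'})" for v
  proof (rule vec.linear_eq_on[OF matrix_vector_mul_linear_gen vec.linear_ident])
    show "v \<in> vec.span (set ys)"
      using that span_canon[OF ys] by simp
    show "g *v b = b" if "b \<in> set ys" for b
      using fix_ys that by (metis map_eq_conv map_idI map_ident)
  qed
  have inj_g: "inj ((*v) g)"
    using \<open>invertible g\<close> by (simp add: invertible_left_inverse matrix_left_invertible_injective)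
  show ?case
  proof (cases "x \<in> vec.span (e ` {..<i'})")
    case True
    then have "g *v x = x"
      by (rule fix_g)
    \<comment> \<open>This excludes the alternative that the head is a new basis vector, so neither
      rank grows.\<close>
    moreover have "e i' \<notin> vec.span (e ` {..<i'})" if "i = Suc i' \<or> j = Suc i'"
      using that Suc.prems notin_span_initial[of i'] by auto
    ultimately show ?thesis
      using True x gx xs fix_ys \<open>i' = j'\<close> by auto
  next
    case False
    \<comment> \<open>If g x were in the span, g would fix it, and g (g x) = g x would give g x = x
      by injectivity, against the choice of x.\<close>
    have "g *v x \<notin> vec.span (e ` {..<i'})"
      using False fix_g inj_g by (metis injD)
    then show ?thesis
      using False x gx xs fix_ys \<open>i' = j'\<close> by auto
  qed
qed

lemma card_GL_orbits:
  "card (GL_orbits n :: ('a ^ 'm) list set set) = (\<Sum>i\<le>CARD('m). card (canon e n i))"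
proof -
  let ?T = "\<Union>i\<le>CARD('m). canon e n i"
  interpret group_action "GL :: ('a ^ 'm ^ 'm) monoid" "tuples n" "GL_action n"
    by (rule group_action_GL)
  have "card (GL_orbits n :: ('a ^ 'm) list set set) = card ?T"
    unfolding GL_orbits_def
  proof (rule card_orbits_transversal)
    show "?T \<subseteq> tuples n"
      using canon_subset_tuples by blast
    show "\<exists>c\<in>?T. c \<in> orbit GL (GL_action n) xs" if "xs \<in> tuples n" for xs :: "('a ^ 'm) list"
      using canon_exists[of xs] that by (auto simp: GL_orbit_iff tuples_def)
    show "c = c'" if c: "c \<in> ?T" "c' \<in> ?T" and orb: "c' \<in> orbit GL (GL_action n) c" for c c'
    proof -
      have "c \<in> tuples n"
        using c(1) canon_subset_tuples by blast
      then obtain g where "invertible g" "c' = map ((*v) g) c"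
        using orb GL_orbit_iff by blast
      then show ?thesis
        using c canon_unique by (metis UN_E atMost_iff)
    qed
  qed
  also have "\<dots> = (\<Sum>i\<le>CARD('m). card (canon e n i))"
  proof (rule card_UN_disjoint)
    \<comment> \<open>Uniqueness applied to the identity matrix shows that a tuple is canonical for
      one rank only.\<close>
    have "i = j" if "xs \<in> canon e n i" "xs \<in> canon e n j" "i \<le> CARD('m)" "j \<le> CARD('m)" for xs i j
      using canon_unique[of xs n i "mat 1" j] that
      by (simp add: invertible_mat_1 map_idI)
    then show "\<forall>i\<in>{..CARD('m)}. \<forall>j\<in>{..CARD('m)}. i \<noteq> j \<longrightarrow> canon e n i \<inter> canon e n j = {}"
      by blast
  qed (auto simp: finite_canon)
  finally show ?thesis .
qed

lemma canon_gf:
  assumes "i \<le> CARD('m)"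
  shows "Abs_fps (\<lambda>n. of_nat (card (canon e n i))) =
    (fps_X ^ i * (\<Prod>r=0..i. 1 / (1 - fps_const (of_nat (CARD('a) ^ r)) * fps_X)) :: rat fps)"
  using assms
proof (induction i)
  case 0
  let ?F = "Abs_fps (\<lambda>n. of_nat (card (canon e n 0))) :: rat fps"
  \<comment> \<open>The summand 1 is the empty tuple, the only canonical tuple of length 0.\<close>
  have "?F = 1 + fps_const (of_nat (CARD('a) ^ 0)) * ?F * fps_X"
    by (rule fps_ext, rename_tac n, case_tac n)
      (simp_all add: card_canon_Suc del: canon.simps(2))
  from fps_eq_divide_geometric[OF this] show ?case
    by simp
next
  case (Suc i)
  let ?F = "\<lambda>i. Abs_fps (\<lambda>n. of_nat (card (canon e n i))) :: rat fps"
  \<comment> \<open>There is no constant term, since the empty tuple has rank 0. The factor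
    \<open>fps_X\<close> is the shift for the entry that raises the rank.\<close>
  have "?F (Suc i) = fps_X * ?F i + fps_const (of_nat (CARD('a) ^ Suc i)) * ?F (Suc i) * fps_X"
    using Suc.prems by (intro fps_ext, rename_tac n, case_tac n)
      (simp_all add: card_canon_Suc del: canon.simps(2) power_Suc of_nat_power)
  from fps_eq_divide_geometric[OF this] show ?case
    using Suc by (simp add: mult_ac)
qed

end

theorem theorem8:
  fixes q m :: nat
  assumes "q = CARD('a::{field,finite})"
    and "m = CARD('m::finite)"
  shows "Abs_fps (\<lambda>n. of_nat (card (GL_orbits n :: ('a ^ 'm) list set set))) =
    (\<Sum>i=0..m. fps_X ^ i * (\<Prod>r=0..i. 1 / (1 - fps_const (of_nat (q ^ r)) * fps_X)) :: rat fps)"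
proof -
  \<comment> \<open>The standard basis, numbered from 0, serves as the fixed basis.\<close>
  obtain e :: "nat \<Rightarrow> 'a ^ 'm" where e: "bij_betw e {..<CARD('m)} cart_basis"
    using ex_bij_betw_nat_finite[OF finite_cart_basis] by (metis card_cart_basis atLeast0LessThan)
  have inj: "inj_on e {..<CARD('m)}" and ind: "vec.independent (e ` {..<CARD('m)})"
    using e vec.independent_Basis by (auto simp: bij_betw_def)
  have "Abs_fps (\<lambda>n. of_nat (card (GL_orbits n :: ('a ^ 'm) list set set))) =
    (\<Sum>i\<le>CARD('m). Abs_fps (\<lambda>n. of_nat (card (canon e n i))) :: rat fps)"
    by (rule fps_ext) (simp add: card_GL_orbits[OF inj ind] fps_sum_nth)
  also have "\<dots> = (\<Sum>i\<le>CARD('m). fps_X ^ i *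
      (\<Prod>r=0..i. 1 / (1 - fps_const (of_nat (CARD('a) ^ r)) * fps_X)))"
    by (rule sum.cong) (simp_all only: canon_gf[OF inj ind] atMost_iff)
  finally show ?thesis
    by (simp only: assms atLeast0AtMost)
qed

end
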